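(* Let $k$ be a field and let $f(x)\in k[x]$ be a nonzero polynomial. Then $\operatorname{tol}(f)\in k^\times$ (that is, the element $\operatorname{tol}(f)$, defined a priori in an algebraic closure $\overline{k}$, is a nonzero element of $k$).
   Context: Let $k$ be a field with algebraic closure $\overline{k}$, and let $f=a_nx^n+\ldots+a_0\in k[x]$ with $a_n\neq 0$. Write $f=a_n\prod_{i=1}^s(x-r_i)^{m_i}$ for the factorization of $f$ over $\overline{k}$, where $r_1,\ldots,r_s\in\overline{k}$ are distinct and $m_i\geq 1$. The tolerant of $f$ is $\operatorname{tol}(f):=a_n^{2n-2}\prod_{1\leq i<j\leq s}(r_i-r_j)^{2m_im_j}\in\overline{k}$. *)

theory Defs
  imports "HOL-Algebra.Algebraic_Closure_Type"
begin

definition root_factorization ::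
  "'a::field poly \<Rightarrow> nat \<Rightarrow> (nat \<Rightarrow> 'a alg_closure) \<Rightarrow> (nat \<Rightarrow> nat) \<Rightarrow> bool" where
  "root_factorization f s r m \<longleftrightarrow>
     inj_on r {1..s} \<and> (\<forall>i\<in>{1..s}. m i \<ge> 1) \<and>
     map_poly to_ac f = smult (to_ac (lead_coeff f)) (\<Prod>i=1..s. [:- r i, 1:] ^ m i)"

text \<open>
  The power of the leading coefficient is an integer power because the exponent
  \<open>2 * n - 2\<close> is negative for nonzero constants: there the tolerant is \<open>a\<^sub>0\<close> to the power \<open>-2\<close>.
\<close>
definition tolerant_expr ::
  "'a::field poly \<Rightarrow> nat \<Rightarrow> (nat \<Rightarrow> 'a alg_closure) \<Rightarrow> (nat \<Rightarrow> nat) \<Rightarrow> 'a alg_closure" where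
  "tolerant_expr f s r m =
     to_ac (lead_coeff f) powi (2 * int (degree f) - 2) *
     (\<Prod>(i, j) \<in> {(i, j). 1 \<le> i \<and> i < j \<and> j \<le> s}. (r i - r j) ^ (2 * m i * m j))"

text \<open>
  For nonzero \<open>f\<close> a factorization exists and all of them (they differ by the numbering of
  the roots) give the same value; see \<open>tol_eq\<close> and \<open>root_factorization_exists\<close> below.
\<close>
definition tol :: "'a::field poly \<Rightarrow> 'a alg_closure" where
  "tol f = (THE t. \<exists>s r m. root_factorization f s r m \<and> t = tolerant_expr f s r m)"

lemma root_factorization_exists:
  fixes f :: "'a::field poly"
  assumes "f \<noteq> 0"
  shows "\<exists>s r m. root_factorization f s r m"
proof -
  define F where "F = map_poly to_ac f"
  have F0: "F \<noteq> 0" using assms by (simp add: F_def map_poly_eq_0_iff)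
  have lc: "lead_coeff F = to_ac (lead_coeff f)"
    by (simp add: F_def coeff_map_poly degree_map_poly)
  obtain A where A: "size A = degree F"
    "F = smult (lead_coeff F) (\<Prod>x\<in>#A. [:- x, 1:])"
    using alg_closed_imp_factorization[OF F0] by blast
  obtain h where h: "bij_betw h {1..card (set_mset A)} (set_mset A)"
    using ex_bij_betw_nat_finite_1[OF finite_set_mset] by blast
  have "(\<Prod>x\<in>#A. [:- x, 1:]) = (\<Prod>x\<in>set_mset A. [:- x, 1:] ^ count A x)"
    by (rule image_prod_mset_multiplicity)
  also have "\<dots> = (\<Prod>i=1..card (set_mset A). [:- h i, 1:] ^ count A (h i))"
    by (rule prod.reindex_bij_betw[OF h, symmetric])
  finally have "root_factorization f (card (set_mset A)) h (\<lambda>i. count A (h i))"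
    unfolding root_factorization_def
    using A(2) lc bij_betw_imp_inj_on[OF h] bij_betw_apply[OF h]
    by (auto simp: F_def Suc_le_eq)
  thus ?thesis by blast
qed

lemma root_factorization_roots:
  fixes f :: "'a::field poly"
  assumes "f \<noteq> 0" and fac: "root_factorization f s r m"
  shows "r ` {1..s} = {x. poly (map_poly to_ac f) x = 0}"
    and "i \<in> {1..s} \<Longrightarrow> m i = order (r i) (map_poly to_ac f)"
proof -
  let ?F = "map_poly to_ac f"
  have F: "?F = smult (to_ac (lead_coeff f)) (\<Prod>i=1..s. [:- r i, 1:] ^ m i)"
    and inj: "inj_on r {1..s}" and m: "\<And>i. i \<in> {1..s} \<Longrightarrow> m i \<ge> 1"
    using fac by (auto simp: root_factorization_def)
  have F0: "?F \<noteq> 0" using assms by (simp add: map_poly_eq_0_iff)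
  have "poly ?F x = 0 \<longleftrightarrow> x \<in> r ` {1..s}" for x
  proof -
    have "poly ?F x = 0 \<longleftrightarrow> (\<exists>i\<in>{1..s}. (x - r i) ^ m i = 0)"
      using \<open>f \<noteq> 0\<close> by (subst F) (simp add: poly_prod)
    also have "\<dots> \<longleftrightarrow> x \<in> r ` {1..s}"
      using m by (force simp: power_0_left)
    finally show ?thesis .
  qed
  thus "r ` {1..s} = {x. poly ?F x = 0}" by blast
  assume i: "i \<in> {1..s}"
  have "proots ?F = (\<Sum>j=1..s. repeat_mset (m j) {#r j#})"
    using \<open>f \<noteq> 0\<close> by (subst F) (simp add: proots_prod proots_power)
  hence "count (proots ?F) (r i) = (\<Sum>j=1..s. count (repeat_mset (m j) {#r j#}) (r i))"
    by (simp only: count_sum)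
  also have "\<dots> = (\<Sum>j=1..s. if j = i then m j else 0)"
  proof (rule sum.cong[OF refl])
    fix j assume "j \<in> {1..s}"
    thus "count (repeat_mset (m j) {#r j#}) (r i) = (if j = i then m j else 0)"
      using inj_onD[OF inj _ _ i, of j] by auto
  qed
  also have "\<dots> = m i" using i by simp
  finally show "m i = order (r i) ?F" using F0 i by simp
qed

lemma tolerant_expr_unique:
  fixes f :: "'a::field poly"
  assumes "f \<noteq> 0" and fac: "root_factorization f s r m" and fac': "root_factorization f s' r' m'"
  shows "tolerant_expr f s r m = tolerant_expr f s' r' m'"
proof -
  let ?F = "map_poly to_ac f"
  define R where "R = {x. poly ?F x = 0}"
  define g where "g a b = (a - b) ^ (2 * order a ?F * order b ?F)" for a b
  define h where "h P = (THE v. \<exists>a b. P = {a, b} \<and> a \<noteq> b \<and> v = g a b)" for P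
  have g_sym: "g a b = g b a" for a b
  proof -
    have "(a - b) ^ 2 = (b - a) ^ 2" by (rule power2_commute)
    hence "((a - b) ^ 2) ^ (order a ?F * order b ?F) = ((b - a) ^ 2) ^ (order b ?F * order a ?F)"
      by (simp only: mult.commute)
    thus ?thesis by (simp only: g_def power_mult [symmetric] mult.assoc)
  qed
  have h: "h {a, b} = g a b" if "a \<noteq> b" for a b
    unfolding h_def using that g_sym by (intro the_equality) (auto simp: doubleton_eq_iff)
  have key: "(\<Prod>(i, j) \<in> {(i, j). 1 \<le> i \<and> i < j \<and> j \<le> s}. (r i - r j) ^ (2 * m i * m j)) =
      (\<Prod>P \<in> {P. P \<subseteq> R \<and> card P = 2}. h P)"
    if fac: "root_factorization f s r m" for s r m
  proof -
    let ?I = "{(i, j). 1 \<le> i \<and> i < j \<and> j \<le> s}"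
    note R = root_factorization_roots(1)[OF \<open>f \<noteq> 0\<close> fac, folded R_def]
    note m = root_factorization_roots(2)[OF \<open>f \<noteq> 0\<close> fac]
    have inj: "inj_on r {1..s}" using fac by (simp add: root_factorization_def)
    have ne: "r i \<noteq> r j" if "(i, j) \<in> ?I" for i j
      using that inj by (auto dest: inj_onD)
    have "bij_betw (\<lambda>(i, j). {r i, r j}) ?I {P. P \<subseteq> R \<and> card P = 2}"
      unfolding bij_betw_def
    proof
      have "i = i' \<and> j = j'"
        if "(i, j) \<in> ?I" "(i', j') \<in> ?I" "{r i, r j} = {r i', r j'}" for i j i' j'
      proof -
        have "r ` {i, j} = r ` {i', j'}" using that(3) by simp
        hence "{i, j} = {i', j'}"
          using that(1,2) by (subst (asm) inj_on_image_eq_iff[OF inj]) auto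
        thus ?thesis using that(1,2) by (auto simp: doubleton_eq_iff)
      qed
      thus "inj_on (\<lambda>(i, j). {r i, r j}) ?I"
        by (intro inj_onI) (simp only: split_paired_all case_prod_conv prod.inject)
      show "(\<lambda>(i, j). {r i, r j}) ` ?I = {P. P \<subseteq> R \<and> card P = 2}"
      proof (intro equalityI subsetI)
        fix P assume "P \<in> (\<lambda>(i, j). {r i, r j}) ` ?I"
        then obtain i j where ij: "(i, j) \<in> ?I" "P = {r i, r j}" by auto
        thus "P \<in> {P. P \<subseteq> R \<and> card P = 2}" using ne[OF ij(1)] R[symmetric] by auto
      next
        fix P assume "P \<in> {P. P \<subseteq> R \<and> card P = 2}"
        hence sub: "P \<subseteq> r ` {1..s}" and "card P = 2" unfolding R by blast+
        then obtain a b where ab: "P = {a, b}" "a \<noteq> b" by (meson card_2_iff)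
        hence "a \<in> r ` {1..s}" "b \<in> r ` {1..s}" using sub by blast+
        with ab obtain i j where ij: "i \<in> {1..s}" "j \<in> {1..s}" "i \<noteq> j" "P = {r i, r j}"
          by blast
        show "P \<in> (\<lambda>(i, j). {r i, r j}) ` ?I"
        proof (cases "i < j")
          case True thus ?thesis using ij by (intro image_eqI[of _ _ "(i, j)"]) auto
        next
          case False thus ?thesis using ij by (intro image_eqI[of _ _ "(j, i)"]) auto
        qed
      qed
    qed
    from prod.reindex_bij_betw[OF this, of h]
    have "(\<Prod>P \<in> {P. P \<subseteq> R \<and> card P = 2}. h P) = (\<Prod>(i, j)\<in>?I. h {r i, r j})"
      by (simp add: case_prod_unfold)
    also have "\<dots> = (\<Prod>(i, j)\<in>?I. (r i - r j) ^ (2 * m i * m j))"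
    proof (intro prod.cong refl, safe)
      fix i j assume ij: "1 \<le> i" "i < j" "j \<le> s"
      hence "h {r i, r j} = g (r i) (r j)" by (intro h ne) auto
      thus "h {r i, r j} = (r i - r j) ^ (2 * m i * m j)" using ij by (simp add: g_def m)
    qed
    finally show ?thesis by simp
  qed
  show ?thesis unfolding tolerant_expr_def key[OF fac] key[OF fac'] ..
qed

lemma tol_eq:
  assumes "f \<noteq> 0" "root_factorization f s r m"
  shows "tol f = tolerant_expr f s r m"
  unfolding tol_def using assms tolerant_expr_unique[OF assms(1)] by (intro the_equality) blast+

end

theory Submission
  imports Defs
begin

text \<open>
  Up to sign, the product of the \<open>(r\<^sub>i - r\<^sub>j) ^ (2 m\<^sub>i m\<^sub>j)\<close> over the pairs \<open>i < j\<close> is the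
  product of \<open>a - b\<close> over all ordered pairs of roots of \<open>f\<close>, taken with multiplicity, the
  pairs with \<open>a = b\<close> being left out. This second form extends to pairs of polynomials: let
  \<open>E(f, g)\<close> be the product of \<open>a - b\<close> over the roots \<open>a\<close> of \<open>f\<close> and \<open>b\<close> of \<open>g\<close> with
  \<open>a \<noteq> b\<close>. The gain is that \<open>E\<close> is multiplicative in both arguments, so that \<open>E(f, g)\<close> lies
  in \<open>k\<close> for all nonzero \<open>f, g\<close> as soon as it does for irreducible ones.

  For irreducible \<open>f\<close> and \<open>g\<close> there are two cases. If they have no common root, \<open>E(f, g)\<close> is, up to
  leading coefficients, the resultant: the product of the values \<open>g(a)\<close> over the roots \<open>a\<close>
  of \<open>f\<close>. If they have a common root, they are associated, and it remains to treat
  \<open>E(g, g)\<close>, where \<open>g\<close> may be inseparable. All roots of \<open>g\<close> have the same multiplicity \<open>m\<close>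
  (lemma \<open>irreducible_order_le\<close>). Near a root \<open>a\<close> one has \<open>g = (x - a)^m q\<close>, the product of
  \<open>a - b\<close> over the roots \<open>b \<noteq> a\<close> is \<open>q(a)\<close> up to the leading coefficient, and \<open>q(a)\<close> is the
  \<open>m\<close>-th Taylor coefficient of \<open>g\<close> at \<open>a\<close>, which is the value at \<open>a\<close> of a polynomial over
  \<open>k\<close>, the \<open>m\<close>-th Hasse derivative of \<open>g\<close>. So \<open>E(g, g)\<close> too is, up to a factor in \<open>k\<close>,
  a product of values \<open>h(a)\<close> over the roots \<open>a\<close> of \<open>g\<close>, with \<open>h\<close> in \<open>k[x]\<close>.

  That such products of values lie in \<open>k\<close> (lemma \<open>value_prod_in_base_field\<close>) follows from
  the Euclidean algorithm.
\<close>

section \<open>Extending scalars to the algebraic closure\<close>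

abbreviation ac_poly :: "'a::field poly \<Rightarrow> 'a alg_closure poly" where
  "ac_poly \<equiv> map_poly to_ac"

abbreviation base_field :: "'a::field alg_closure set" where
  "base_field \<equiv> range to_ac"

lemma degree_ac_poly: "degree (ac_poly p) = degree p"
  by (rule degree_map_poly) simp

lemma lead_coeff_ac_poly: "lead_coeff (ac_poly p) = to_ac (lead_coeff p)"
  by (simp add: coeff_map_poly degree_ac_poly)

lemma ac_poly_eq_0_iff [simp]: "ac_poly p = 0 \<longleftrightarrow> p = 0"
  by (rule map_poly_eq_0_iff) auto

lemma ac_poly_add: "ac_poly (p + q) = ac_poly p + ac_poly q"
  by (rule poly_eqI) (simp add: coeff_map_poly)

lemma ac_poly_mult: "ac_poly (p * q) = ac_poly p * ac_poly q"
  by (rule poly_eqI) (simp add: coeff_map_poly coeff_mult to_ac_sum)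

lemma base_field_0: "0 \<in> base_field"
  by (rule image_eqI[of _ _ 0]) auto

lemma base_field_1: "1 \<in> base_field"
  by (rule image_eqI[of _ _ 1]) auto

lemma base_field_uminus: "x \<in> base_field \<Longrightarrow> - x \<in> base_field"
  by (auto simp flip: to_ac_minus)

lemma base_field_mult: "x \<in> base_field \<Longrightarrow> y \<in> base_field \<Longrightarrow> x * y \<in> base_field"
  by (auto simp flip: to_ac_mult)

lemma base_field_divide: "x \<in> base_field \<Longrightarrow> y \<in> base_field \<Longrightarrow> x / y \<in> base_field"
  by (auto simp flip: to_ac_divide)

lemma base_field_power: "x \<in> base_field \<Longrightarrow> x ^ n \<in> base_field"
  by (auto simp flip: to_ac_power)

lemma base_field_powi: "x \<in> base_field \<Longrightarrow> x powi n \<in> base_field"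
  by (auto simp: power_int_def simp flip: to_ac_power to_ac_inverse)

lemma base_field_prod: "(\<And>x. x \<in> A \<Longrightarrow> h x \<in> base_field) \<Longrightarrow> (\<Prod>x\<in>A. h x) \<in> base_field"
  by (induction A rule: infinite_finite_induct) (auto intro: base_field_mult base_field_1)

lemma base_field_lead_coeff: "lead_coeff (ac_poly p) \<in> base_field"
  by (simp add: lead_coeff_ac_poly)

lemmas base_field_intros = base_field_0 base_field_1 base_field_uminus base_field_mult
  base_field_divide base_field_power base_field_powi base_field_lead_coeff

lemma alg_closed_poly_eq_prod_proots:
  fixes p :: "'a::alg_closed_field poly"
  assumes "p \<noteq> 0"
  shows "p = smult (lead_coeff p) (\<Prod>x\<in>#proots p. [:- x, 1:])"
    and "size (proots p) = degree p"
proof -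
  obtain A where A: "size A = degree p" "p = smult (lead_coeff p) (\<Prod>x\<in>#A. [:- x, 1:])"
    using alg_closed_imp_factorization[OF assms] by blast
  have "proots (\<Prod>x\<in>#A. [:- x, 1:]) = A"
  proof (induction A)
    case (add x A)
    have "(\<Prod>x\<in>#A. [:- x, 1:]) \<noteq> 0" by (auto simp: prod_mset_zero_iff)
    hence "proots ([:- x, 1:] * (\<Prod>x\<in>#A. [:- x, 1:])) = {#x#} + A"
      using add.IH by (subst proots_mult) auto
    thus ?case by simp
  qed simp
  with A(2) assms have "proots p = A"
    by (metis leading_coeff_0_iff proots_smult)
  with A show "p = smult (lead_coeff p) (\<Prod>x\<in>#proots p. [:- x, 1:])"
    and "size (proots p) = degree p" by simp_all
qed

lemma poly_eq_prod_proots: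
  fixes p :: "'a::alg_closed_field poly"
  assumes "p \<noteq> 0"
  shows "poly p a = lead_coeff p * (\<Prod>x\<in>#proots p. a - x)"
proof -
  have "poly p a = poly (smult (lead_coeff p) (\<Prod>x\<in>#proots p. [:- x, 1:])) a"
    using alg_closed_poly_eq_prod_proots(1)[OF assms] by simp
  thus ?thesis by (simp add: poly_prod_mset image_mset.compositionality o_def)
qed

section \<open>Products of values at roots\<close>

text \<open>
  For monic \<open>p\<close> this is the resultant of \<open>p\<close> and \<open>g\<close>, or equivalently the norm of the class of
  \<open>g\<close> in \<open>k[x]/(p)\<close>.
\<close>
definition value_prod :: "'a::field poly \<Rightarrow> 'a poly \<Rightarrow> 'a alg_closure" where
  "value_prod p g = (\<Prod>a\<in>#proots (ac_poly p). poly (ac_poly g) a)"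

text \<open>
  Both sides are products of the same differences \<open>a - b\<close>, up to sign and leading coefficients.
\<close>
lemma value_prod_flip:
  assumes "p \<noteq> 0" "r \<noteq> 0"
  shows "value_prod p r =
    lead_coeff (ac_poly r) ^ degree p * (-1) ^ (degree p * degree r) *
    (value_prod r p / lead_coeff (ac_poly p) ^ degree r)"
proof -
  let ?P = "proots (ac_poly p)" and ?R = "proots (ac_poly r)"
  have size: "size ?P = degree p" "size ?R = degree r"
    using assms by (simp_all add: alg_closed_poly_eq_prod_proots(2) degree_ac_poly)
  have val: "value_prod p g = lead_coeff (ac_poly g) ^ size (proots (ac_poly p)) *
      (\<Prod>a\<in>#proots (ac_poly p). \<Prod>b\<in>#proots (ac_poly g). a - b)"
    if "g \<noteq> 0" for p g :: "'a poly"
  proof -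
    have "poly (ac_poly g) =
        (\<lambda>a. lead_coeff (ac_poly g) * (\<Prod>b\<in>#proots (ac_poly g). a - b))"
      using that by (intro ext poly_eq_prod_proots) simp
    thus ?thesis by (simp add: value_prod_def prod_mset.distrib)
  qed
  have neg: "(\<Prod>b\<in>#B. a - b) = (-1) ^ size B * (\<Prod>b\<in>#B. b - a)" for B and a :: "'a alg_closure"
    by (induction B) (auto simp: algebra_simps)
  have "(\<Prod>a\<in>#?P. \<Prod>b\<in>#?R. a - b) = (\<Prod>a\<in>#?P. (-1) ^ size ?R * (\<Prod>b\<in>#?R. b - a))"
    by (subst neg) simp
  also have "\<dots> = (-1) ^ (degree p * degree r) * (\<Prod>b\<in>#?R. \<Prod>a\<in>#?P. b - a)"
    by (simp add: prod_mset.distrib size prod_mset.swap[of _ ?R] mult.commute flip: power_mult)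
  finally show ?thesis
    using assms by (simp add: val size)
qed

text \<open>
  The Euclidean algorithm: only \<open>g mod p\<close> matters on the roots of \<open>p\<close>, and interchanging \<open>p\<close>
  with this remainder lowers the degree of the polynomial whose roots are used.
\<close>
lemma value_prod_in_base_field:
  assumes "p \<noteq> 0"
  shows "value_prod p g \<in> base_field"
  using assms
proof (induction "degree p" arbitrary: p g rule: less_induct)
  case less
  define r where "r = g mod p"
  have g: "ac_poly g = ac_poly (g div p) * ac_poly p + ac_poly r"
    by (simp add: r_def flip: ac_poly_add ac_poly_mult)
  have mod: "value_prod p g = value_prod p r"
    unfolding value_prod_def
    by (intro arg_cong[of _ _ prod_mset] image_mset_cong) (use less.prems in \<open>simp add: g\<close>)
  show ?case
  proof (cases "r = 0")
    case True
    \<comment> \<open>All factors are zero; the product is 1 if \<open>p\<close> is constant and has no roots.\<close>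
    then show ?thesis
      unfolding mod by (auto simp: value_prod_def base_field_intros power_0_left)
  next
    case False
    hence "degree r < degree p"
      using degree_mod_less[OF less.prems] unfolding r_def by blast
    hence "value_prod r p \<in> base_field"
      using less.hyps False by blast
    then show ?thesis
      unfolding mod value_prod_flip[OF less.prems False]
      by (intro base_field_intros)
  qed
qed

section \<open>Taylor coefficients\<close>

text \<open>
  The \<open>j\<close>-th derivative divided by \<open>j!\<close>, written with binomial coefficients so that it makes
  sense, and still yields Taylor coefficients, in positive characteristic. For \<open>i < j\<close> the
  truncated exponent \<open>i - j\<close> is harmless because the binomial coefficient is zero.
\<close>
definition hasse_deriv :: "nat \<Rightarrow> 'a::comm_ring_1 poly \<Rightarrow> 'a poly" where
  "hasse_deriv j p = (\<Sum>i\<le>degree p. monom (coeff p i * of_nat (i choose j)) (i - j))"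

lemma poly_hasse_deriv:
  "poly (hasse_deriv j p) a = coeff (pcompose p [:a, 1:]) j"
proof -
  have pow: "coeff ([:a, 1:] ^ i) j = of_nat (i choose j) * a ^ (i - j)" for i
  proof (cases "j \<le> i")
    case True
    thus ?thesis by (simp add: coeff_linear_poly_power)
  next
    case False
    have "degree ([:a, 1:] ^ i) \<le> i"
      using degree_power_le[of "[:a, 1:]" i] by simp
    with False show ?thesis by (simp add: coeff_eq_0 binomial_eq_0)
  qed
  have "pcompose p [:a, 1:] = (\<Sum>i\<le>degree p. smult (coeff p i) ([:a, 1:] ^ i))"
    by (simp add: pcompose_altdef poly_altdef degree_map_poly coeff_map_poly)
  thus ?thesis
    by (simp add: hasse_deriv_def poly_sum poly_monom coeff_sum pow mult.assoc)
qed

lemma ac_poly_hasse_deriv: "ac_poly (hasse_deriv j p) = hasse_deriv j (ac_poly p)"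
  by (rule poly_eqI)
     (auto simp: hasse_deriv_def coeff_map_poly coeff_sum degree_ac_poly to_ac_sum intro!: sum.cong)

lemma degree_hasse_deriv_less:
  assumes "j > 0" "degree p > 0"
  shows "degree (hasse_deriv j p) < degree p"
proof -
  have "degree (monom (coeff p i * of_nat (i choose j)) (i - j)) \<le> degree p - 1"
    if "i \<le> degree p" for i
    using that assms by (intro order.trans[OF degree_monom_le]) auto
  hence "degree (hasse_deriv j p) \<le> degree p - 1"
    unfolding hasse_deriv_def by (intro degree_sum_le) auto
  thus ?thesis using assms by simp
qed

lemma poly_hasse_deriv_root_power:
  fixes q :: "'a::idom poly"
  shows "j < m \<Longrightarrow> poly (hasse_deriv j ([:- a, 1:] ^ m * q)) a = 0"
    and "poly (hasse_deriv m ([:- a, 1:] ^ m * q)) a = poly q a"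
proof -
  have "pcompose ([:- a, 1:] ^ m) [:a, 1:] = monom 1 m"
  proof (induction m)
    case (Suc m)
    have "pcompose ([:- a, 1:] ^ Suc m) [:a, 1:] = [:0, 1:] * monom 1 m"
      using Suc by (simp only: power_Suc pcompose_mult) (simp add: pcompose_pCons)
    thus ?case by (simp add: monom_Suc)
  qed (simp add: pcompose_1)
  hence "pcompose ([:- a, 1:] ^ m * q) [:a, 1:] = monom 1 m * pcompose q [:a, 1:]"
    by (simp add: pcompose_mult)
  thus "j < m \<Longrightarrow> poly (hasse_deriv j ([:- a, 1:] ^ m * q)) a = 0"
    and "poly (hasse_deriv m ([:- a, 1:] ^ m * q)) a = poly q a"
    by (simp_all add: poly_hasse_deriv coeff_monom_mult)
qed

section \<open>Irreducible polynomials\<close>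

text \<open>
  Up to a unit, \<open>g\<close> is the minimal polynomial of \<open>b\<close> over \<open>k\<close>; the latter is obtained as a
  polynomial \<open>q\<close> of least degree among the nonzero ones vanishing at \<open>b\<close>, and it divides
  all of them by division with remainder.
\<close>
lemma irreducible_dvd_of_common_root:
  fixes g h :: "'a::field poly"
  assumes g: "irreducible g" and b: "poly (ac_poly g) b = 0" "poly (ac_poly h) b = 0"
  shows "g dvd h"
proof -
  define Z where "Z p \<longleftrightarrow> p \<noteq> 0 \<and> poly (ac_poly p) b = 0" for p
  have "Z g" using g b by (auto simp: Z_def)
  define q where "q = arg_min degree Z"
  have q: "Z q" unfolding q_def using \<open>Z g\<close> by (rule arg_min_natI)
  have min: "degree q \<le> degree p" if "Z p" for p
    unfolding q_def using that by (rule arg_min_nat_le)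
  have dvd: "q dvd p" if p: "poly (ac_poly p) b = 0" for p
  proof (rule ccontr)
    assume "\<not> q dvd p"
    hence nz: "p mod q \<noteq> 0" by (simp add: dvd_eq_mod_eq_0)
    have "ac_poly p = ac_poly (p div q) * ac_poly q + ac_poly (p mod q)"
      by (simp flip: ac_poly_add ac_poly_mult)
    with p q have "poly (ac_poly (p mod q)) b = 0" by (simp add: Z_def)
    hence "degree q \<le> degree (p mod q)" using nz by (intro min) (simp add: Z_def)
    moreover have "degree (p mod q) < degree q"
      using degree_mod_less[of q p] nz q by (auto simp: Z_def)
    ultimately show False by simp
  qed
  obtain c where c: "g = q * c" using dvd[OF b(1)] by (auto elim: dvdE)
  have "\<not> is_unit q"
  proof
    assume "is_unit q"
    then obtain d where "q = [:d:]" by (auto elim!: is_unit_polyE)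
    with q show False by (auto simp: Z_def map_poly_pCons)
  qed
  with irreducibleD[OF g c] have "is_unit c" by blast
  hence "g dvd q" using c by (simp add: mult_unit_dvd_iff)
  thus ?thesis using dvd[OF b(2)] by (rule dvd_trans)
qed

lemma irreducible_degree_pos:
  fixes g :: "'a::field poly"
  assumes "irreducible g"
  shows "degree g > 0"
proof -
  have "g \<noteq> 0" "\<not> is_unit g" using assms by (auto simp: irreducible_not_unit)
  thus ?thesis by (simp add: is_unit_iff_degree)
qed

text \<open>
  The multiplicity of a root is the first order \<open>m\<close> in which the Taylor expansion at that root is
  nonzero. If \<open>b\<close> had larger multiplicity than \<open>a\<close>, the \<open>m\<close>-th Hasse derivative for the
  multiplicity \<open>m\<close> of \<open>a\<close> would be a nonzero polynomial of smaller degree than \<open>g\<close> with the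
  root \<open>b\<close> of \<open>g\<close>. By symmetry, all roots of \<open>g\<close> have the same multiplicity.
\<close>
lemma irreducible_order_le:
  fixes g :: "'a::field poly"
  assumes g: "irreducible g"
    and a: "poly (ac_poly g) a = 0" and b: "poly (ac_poly g) b = 0"
  shows "order b (ac_poly g) \<le> order a (ac_poly g)"
proof (rule ccontr)
  define m where "m = order a (ac_poly g)"
  assume "\<not> ?thesis"
  hence less: "m < order b (ac_poly g)" by (simp add: m_def)
  have g0: "ac_poly g \<noteq> 0" using g by auto
  obtain q where q: "ac_poly g = [:- a, 1:] ^ m * q" "\<not> [:- a, 1:] dvd q"
    using order_decomp[OF g0] unfolding m_def by blast
  obtain t where t: "ac_poly g = [:- b, 1:] ^ order b (ac_poly g) * t"
    using order_decomp[OF g0] by blast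
  have "poly (ac_poly (hasse_deriv m g)) a \<noteq> 0"
    using q(2) unfolding ac_poly_hasse_deriv
    by (subst q(1)) (simp add: poly_hasse_deriv_root_power poly_eq_0_iff_dvd)
  moreover have "poly (ac_poly (hasse_deriv m g)) b = 0"
    unfolding ac_poly_hasse_deriv
    by (subst t) (rule poly_hasse_deriv_root_power(1)[OF less])
  ultimately have "hasse_deriv m g \<noteq> 0" "g dvd hasse_deriv m g"
    using irreducible_dvd_of_common_root[OF g b] by auto
  hence "degree g \<le> degree (hasse_deriv m g)" by (intro dvd_imp_degree_le)
  moreover have "m > 0" using a g0 by (simp add: m_def order_gt_0_iff)
  ultimately show False
    using degree_hasse_deriv_less[of m g] irreducible_degree_pos[OF g] by simp
qed

lemma poly_irreducible_induct [consumes 1, case_names unit irreducible mult]: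
  fixes f :: "'a::field poly"
  assumes "f \<noteq> 0"
    and unit: "\<And>p. is_unit p \<Longrightarrow> P p"
    and irred: "\<And>p. irreducible p \<Longrightarrow> P p"
    and mult: "\<And>p q. p \<noteq> 0 \<Longrightarrow> q \<noteq> 0 \<Longrightarrow> P p \<Longrightarrow> P q \<Longrightarrow> P (p * q)"
  shows "P f"
  using \<open>f \<noteq> 0\<close>
proof (induction "degree f" arbitrary: f rule: less_induct)
  case less
  show ?case
  proof (cases "is_unit f \<or> irreducible f")
    case True
    thus ?thesis using unit irred by blast
  next
    case False
    then obtain p q where f: "f = p * q" "\<not> is_unit p" "\<not> is_unit q"
      using less.prems unfolding irreducible_def by blast
    with less.prems have nz: "p \<noteq> 0" "q \<noteq> 0" by auto
    hence "degree p > 0" "degree q > 0" using f by (auto simp: is_unit_iff_degree)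
    moreover have "degree f = degree p + degree q" using f(1) nz by (simp add: degree_mult_eq)
    ultimately show ?thesis unfolding f(1) using nz by (intro mult less.hyps) (auto simp: f(1))
  qed
qed

section \<open>Products of nonzero root differences\<close>

text \<open>
  The value 1 on the diagonal removes the pairs of equal roots from products over all pairs.
\<close>
definition root_diff :: "'a::field \<Rightarrow> 'a \<Rightarrow> 'a" where
  "root_diff a b = (if a = b then 1 else a - b)"

definition root_diff_prod :: "'a::field poly \<Rightarrow> 'a poly \<Rightarrow> 'a alg_closure" where
  "root_diff_prod f g = (\<Prod>a\<in>#proots (ac_poly f). \<Prod>b\<in>#proots (ac_poly g). root_diff a b)"

lemma proots_ac_poly_mult:
  "p \<noteq> 0 \<Longrightarrow> q \<noteq> 0 \<Longrightarrow> proots (ac_poly (p * q)) = proots (ac_poly p) + proots (ac_poly q)"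
  by (simp add: ac_poly_mult proots_mult)

lemma proots_ac_poly_unit: "is_unit p \<Longrightarrow> proots (ac_poly p) = {#}"
  by (auto elim!: is_unit_polyE simp: map_poly_pCons)

text \<open>
  The common reduction of the two irreducible cases: it suffices to find one polynomial \<open>h\<close> over
  \<open>k\<close> that computes the inner product at every root of \<open>f\<close>.
\<close>
lemma root_diff_prod_via_value_prod:
  assumes "f \<noteq> 0" "c \<in> base_field"
    and val: "\<And>a. poly (ac_poly f) a = 0 \<Longrightarrow>
           (\<Prod>b\<in>#proots (ac_poly g). root_diff a b) = poly (ac_poly h) a / c"
  shows "root_diff_prod f g \<in> base_field"
proof -
  have "root_diff_prod f g = (\<Prod>a\<in>#proots (ac_poly f). poly (ac_poly h) a * (1 / c))"
    unfolding root_diff_prod_def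
    by (intro arg_cong[of _ _ prod_mset] image_mset_cong) (use assms in simp)
  also have "\<dots> = value_prod f h * (1 / c) ^ size (proots (ac_poly f))"
    by (simp only: prod_mset.distrib value_prod_def) simp
  finally show ?thesis
    using assms by (auto intro!: base_field_intros value_prod_in_base_field)
qed

lemma root_diff_prod_coprime:
  assumes nz: "f \<noteq> 0" "g \<noteq> 0"
    and no_common: "\<And>a. poly (ac_poly f) a = 0 \<Longrightarrow> poly (ac_poly g) a \<noteq> 0"
  shows "root_diff_prod f g \<in> base_field"
proof (rule root_diff_prod_via_value_prod[OF nz(1) base_field_lead_coeff])
  fix a assume a: "poly (ac_poly f) a = 0"
  have "(\<Prod>b\<in>#proots (ac_poly g). root_diff a b) = (\<Prod>b\<in>#proots (ac_poly g). a - b)"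
    by (intro arg_cong[of _ _ prod_mset] image_mset_cong)
       (use nz no_common[OF a] in \<open>auto simp: root_diff_def\<close>)
  thus "(\<Prod>b\<in>#proots (ac_poly g). root_diff a b) = poly (ac_poly g) a / lead_coeff (ac_poly g)"
    using nz by (simp add: poly_eq_prod_proots)
qed

text \<open>
  The inner product at a root \<open>a\<close> is the leading Taylor coefficient of \<open>g\<close> at \<open>a\<close>. Since the
  multiplicity \<open>m\<close> does not depend on \<open>a\<close>, a single Hasse derivative computes it at all roots.
\<close>
lemma root_diff_prod_irreducible_self:
  assumes g: "irreducible g"
  shows "root_diff_prod g g \<in> base_field"
proof -
  have nz: "g \<noteq> 0" using g by auto
  hence G0: "ac_poly g \<noteq> 0" by simp
  obtain m where m: "\<And>a. poly (ac_poly g) a = 0 \<Longrightarrow> order a (ac_poly g) = m"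
    using irreducible_order_le[OF g] by (metis order.antisym)
  show ?thesis
  proof (rule root_diff_prod_via_value_prod[OF nz base_field_lead_coeff])
    fix a assume a: "poly (ac_poly g) a = 0"
    obtain q where q: "ac_poly g = [:- a, 1:] ^ m * q" "\<not> [:- a, 1:] dvd q"
      using order_decomp[OF G0, of a] unfolding m[OF a] by blast
    have q0: "q \<noteq> 0" using q(2) by auto
    have qa: "poly q a \<noteq> 0" using q(2) by (simp add: poly_eq_0_iff_dvd)
    have "proots (ac_poly g) = repeat_mset m {#a#} + proots q"
      unfolding q(1) using q0 by (subst proots_mult) (auto simp: proots_power)
    moreover have "(\<Prod>b\<in>#repeat_mset m {#a#}. root_diff a b) = 1"
      by (simp add: root_diff_def)
    moreover have "(\<Prod>b\<in>#proots q. root_diff a b) = (\<Prod>b\<in>#proots q. a - b)"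
      by (intro arg_cong[of _ _ prod_mset] image_mset_cong)
         (use q0 qa in \<open>auto simp: root_diff_def\<close>)
    ultimately have "(\<Prod>b\<in>#proots (ac_poly g). root_diff a b) = (\<Prod>b\<in>#proots q. a - b)"
      by simp
    also have "\<dots> = poly q a / lead_coeff (ac_poly g)"
      using q0 by (simp add: poly_eq_prod_proots q(1) lead_coeff_mult lead_coeff_power)
    also have "poly q a = poly (ac_poly (hasse_deriv m g)) a"
      unfolding ac_poly_hasse_deriv q(1) by (simp add: poly_hasse_deriv_root_power)
    finally show "(\<Prod>b\<in>#proots (ac_poly g). root_diff a b) =
        poly (ac_poly (hasse_deriv m g)) a / lead_coeff (ac_poly g)" .
  qed
qed

lemma root_diff_prod_irreducible:
  assumes f: "irreducible f" and g: "irreducible g"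
  shows "root_diff_prod f g \<in> base_field"
proof (cases "\<exists>a. poly (ac_poly f) a = 0 \<and> poly (ac_poly g) a = 0")
  case False
  thus ?thesis using f g by (intro root_diff_prod_coprime) auto
next
  case True
  then have "f dvd g" using irreducible_dvd_of_common_root[OF f] by blast
  then obtain c where c: "g = f * c" by (auto elim: dvdE)
  hence "is_unit c" using irreducibleD[OF g c] irreducible_not_unit[OF f] by blast
  hence "proots (ac_poly g) = proots (ac_poly f)"
    using c f by (subst c, subst proots_ac_poly_mult) (auto simp: proots_ac_poly_unit)
  hence "root_diff_prod f g = root_diff_prod f f" by (simp add: root_diff_prod_def)
  with root_diff_prod_irreducible_self[OF f] show ?thesis by simp
qed

lemma root_diff_prod_in_base_field:
  assumes "f \<noteq> 0" "g \<noteq> 0"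
  shows "root_diff_prod f g \<in> base_field"
  using assms(1)
proof (induction f rule: poly_irreducible_induct)
  case (unit p)
  thus ?case by (simp add: root_diff_prod_def proots_ac_poly_unit base_field_1)
next
  case (mult p q)
  thus ?case by (simp add: root_diff_prod_def proots_ac_poly_mult base_field_mult)
next
  case (irreducible p)
  show ?case
    using assms(2)
  proof (induction g rule: poly_irreducible_induct)
    case (unit q)
    thus ?case by (simp add: root_diff_prod_def proots_ac_poly_unit base_field_1)
  next
    case (mult q r)
    thus ?case
      by (simp add: root_diff_prod_def proots_ac_poly_mult prod_mset.distrib base_field_mult)
  next
    case (irreducible q)
    with \<open>irreducible p\<close> show ?case by (rule root_diff_prod_irreducible)
  qed
qed

section \<open>The tolerant\<close>

lemma prod_offdiag_symmetric:
  fixes h :: "nat \<Rightarrow> nat \<Rightarrow> 'a::comm_monoid_mult"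
  assumes "\<And>i. h i i = 1"
  shows "(\<Prod>i=1..s. \<Prod>j=1..s. h i j) =
    (\<Prod>(i, j) \<in> {(i, j). 1 \<le> i \<and> i < j \<and> j \<le> s}. h i j * h j i)"
proof -
  let ?U = "{(i, j). 1 \<le> i \<and> i < j \<and> j \<le> s}" and ?D = "(\<lambda>i. (i, i)) ` {1..s}"
  have fin: "finite ?U" by (rule finite_subset[of _ "{1..s} \<times> {1..s}"]) auto
  have "{1..s} \<times> {1..s} = (?U \<union> prod.swap ` ?U) \<union> ?D"
    by (auto simp: image_iff not_less)
  hence "(\<Prod>i=1..s. \<Prod>j=1..s. h i j) = (\<Prod>(i, j) \<in> (?U \<union> prod.swap ` ?U) \<union> ?D. h i j)"
    by (simp add: prod.cartesian_product)
  also have "\<dots> = (\<Prod>(i, j) \<in> ?U. h i j) * (\<Prod>(i, j) \<in> prod.swap ` ?U. h i j) * (\<Prod>(i, j) \<in> ?D. h i j)"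
    using fin by (subst prod.union_disjoint; (subst prod.union_disjoint)?) auto
  also have "(\<Prod>(i, j) \<in> ?D. h i j) = 1"
    using assms by (auto intro!: prod.neutral)
  also have "(\<Prod>(i, j) \<in> prod.swap ` ?U. h i j) = (\<Prod>(i, j) \<in> ?U. h j i)"
    by (subst prod.reindex) (auto simp: inj_on_def case_prod_unfold)
  finally show ?thesis by (simp add: case_prod_unfold prod.distrib)
qed

text \<open>
  Each unordered pair contributes both \<open>r\<^sub>i - r\<^sub>j\<close> and \<open>r\<^sub>j - r\<^sub>i\<close>, whose product is
  \<open>- (r\<^sub>i - r\<^sub>j)\<^sup>2\<close>; this is where the signs come from.
\<close>
lemma root_diff_prod_self_eq:
  assumes "f \<noteq> 0" and fac: "root_factorization f s r m"
  shows "root_diff_prod f f =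
    (\<Prod>(i, j) \<in> {(i, j). 1 \<le> i \<and> i < j \<and> j \<le> s}.
      (-1) ^ (m i * m j) * (r i - r j) ^ (2 * m i * m j))"
proof -
  let ?F = "ac_poly f"
  have inj: "inj_on r {1..s}" using fac by (simp add: root_factorization_def)
  have by_index: "(\<Prod>a\<in>#proots ?F. h a) = (\<Prod>i=1..s. h (r i) ^ m i)"
    for h :: "'a alg_closure \<Rightarrow> 'a alg_closure"
  proof -
    have "(\<Prod>a\<in>#proots ?F. h a) = (\<Prod>a\<in>r ` {1..s}. h a ^ order a ?F)"
      using \<open>f \<noteq> 0\<close> root_factorization_roots(1)[OF assms]
      by (simp add: image_prod_mset_multiplicity)
    also have "\<dots> = (\<Prod>i=1..s. h (r i) ^ m i)"
      using root_factorization_roots(2)[OF assms] by (subst prod.reindex[OF inj]) simp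
    finally show ?thesis .
  qed
  have "root_diff_prod f f = (\<Prod>i=1..s. \<Prod>j=1..s. root_diff (r i) (r j) ^ (m i * m j))"
    unfolding root_diff_prod_def by_index
    by (simp add: prod_power_distrib mult.commute flip: power_mult)
  also have "\<dots> = (\<Prod>(i, j) \<in> {(i, j). 1 \<le> i \<and> i < j \<and> j \<le> s}.
      root_diff (r i) (r j) ^ (m i * m j) * root_diff (r j) (r i) ^ (m j * m i))"
    by (rule prod_offdiag_symmetric) (simp add: root_diff_def)
  also have "\<dots> = (\<Prod>(i, j) \<in> {(i, j). 1 \<le> i \<and> i < j \<and> j \<le> s}.
      (-1) ^ (m i * m j) * (r i - r j) ^ (2 * m i * m j))"
  proof (intro prod.cong refl, safe)
    fix i j assume ij: "1 \<le> i" "i < j" "j \<le> s"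
    hence ne: "r i \<noteq> r j" using inj by (auto dest: inj_onD)
    have "root_diff (r i) (r j) ^ (m i * m j) * root_diff (r j) (r i) ^ (m j * m i) =
        ((-1) * (r i - r j) ^ 2) ^ (m i * m j)"
      using ne by (simp add: root_diff_def power2_eq_square algebra_simps flip: power_mult_distrib)
    also have "\<dots> = (-1) ^ (m i * m j) * (r i - r j) ^ (2 * m i * m j)"
      by (simp only: power_mult_distrib mult.assoc flip: power_mult)
    finally show "root_diff (r i) (r j) ^ (m i * m j) * root_diff (r j) (r i) ^ (m j * m i) =
        (-1) ^ (m i * m j) * (r i - r j) ^ (2 * m i * m j)" .
  qed
  finally show ?thesis .
qed

theorem theorem1p3:
  fixes f :: "'k::field poly"
  assumes "f \<noteq> 0"
  shows "tol f \<in> to_ac ` {c :: 'k. c \<noteq> 0}"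
proof -
  obtain s r m where fac: "root_factorization f s r m"
    using root_factorization_exists[OF assms] by blast
  have inj: "inj_on r {1..s}" using fac by (simp add: root_factorization_def)
  let ?I = "{(i, j). 1 \<le> i \<and> i < j \<and> j \<le> s}"
  define S where "S = (\<Prod>(i, j) \<in> ?I. (-1 :: 'k alg_closure) ^ (m i * m j))"
  define T where "T = (\<Prod>(i, j) \<in> ?I. (r i - r j) ^ (2 * m i * m j))"
  have fin: "finite ?I" by (rule finite_subset[of _ "{1..s} \<times> {1..s}"]) auto
  have S: "S \<in> base_field" "S \<noteq> 0"
    using fin by (auto simp: S_def intro!: base_field_prod base_field_intros)
  have "root_diff_prod f f = S * T"
    unfolding root_diff_prod_self_eq[OF assms fac] S_def T_def
    by (simp add: case_prod_unfold prod.distrib)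
  hence "T = root_diff_prod f f / S" using S by simp
  hence "T \<in> base_field"
    using S assms by (auto intro!: base_field_divide root_diff_prod_in_base_field)
  moreover have "T \<noteq> 0"
    using fin inj by (auto simp: T_def dest: inj_onD)
  moreover have tol: "tol f = to_ac (lead_coeff f) powi (2 * int (degree f) - 2) * T"
    using tol_eq[OF assms fac] by (simp add: tolerant_expr_def T_def)
  ultimately have "tol f \<in> base_field" "tol f \<noteq> 0"
    using assms by (auto intro!: base_field_mult base_field_powi simp: power_int_eq_0_iff)
  thus ?thesis by auto
qed

end
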